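(* Let $G$ be a $3$-edge-connected cubic graph (multiple edges allowed) and let $(T,\varphi)$ be a cactus tree of $G$. Let $A \subseteq V(G)$ with $|\delta(A)| = 3$, $\bar A = V(G)\setminus A$, and let $G_1 = G/A$ (all of $A$ identified into a new vertex $a$) and $G_2 = G/\bar A$ (all of $\bar A$ identified into a new vertex $\bar a$), keeping multiple edges and deleting loops. Let $e = x_1x_2$ be the edge of $T$ corresponding to $A$, that is, the components of $T - e$ are trees $T_1'$ and $T_2'$ with $x_i \in V(T_i')$ and $A = \varphi^{-1}(V(T_2'))$. For $i = 1,2$ let $T_i = T_i' + e$ (the tree $T_i'$ together with the edge $e$ and its other endpoint). Define $\varphi_1 : V(G_1) \to V(T_1)$ as the restriction of $\varphi$ to $\bar A$ together with $\varphi_1(a) = x_2$, and define $\varphi_2 : V(G_2) \to V(T_2)$ as the restriction of $\varphi$ to $A$ together with $\varphi_2(\bar a) = x_1$. Then $(T_i,\varphi_i)$ is a cactus tree of $G_i$ for $i = 1,2$.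
   Context: For a graph $H$ and $X \subseteq V(H)$, $\delta(X)$ denotes the set of edges with exactly one endpoint in $X$. A $3$-edge-connected graph is one that remains connected whenever fewer than $3$ edges are removed. For a $3$-edge-connected cubic graph $H$, a cactus tree (tree of cuts) of $H$ is a pair $(T,\varphi)$ where $T$ is a tree (thought of with every edge doubled, so that its minimum cuts are exactly those obtained by deleting one tree edge) and $\varphi : V(H) \to V(T)$ is a map such that: (1) for every edge $f$ of $T$ and the vertex set $S$ of one component of $T - f$, the set $X = \varphi^{-1}(S)$ is a nonempty proper subset of $V(H)$ with $|\delta(X)| = 3$ (a minimum cut of $H$); and (2) conversely, for every nonempty proper $X \subseteq V(H)$ with $|\delta(X)| = 3$ there is an edge $f$ of $T$ and a component of $T-f$ with vertex set $S$ such that $X = \varphi^{-1}(S)$. Nodes of $T$ not in the image of $\varphi$ are called empty nodes. *)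

theory Defs
  imports Main
begin

text \<open>
  Undirected multigraphs with named edges: \<open>ends G e\<close> is the set of endpoints of \<open>e\<close>,
  a singleton exactly when \<open>e\<close> is a loop. The trees of AFP's Graph_Theory are digraphs without
  directed cycles, which is not the notion of an undirected tree, and its symmetric digraphs
  do not track edge multiplicities. The function \<open>ends G\<close> is total, but only its values on
  \<open>edges G\<close> matter; subgraphs inherit it unchanged.
\<close>

record ('v, 'e) mgraph =
  verts :: "'v set"
  edges :: "'e set"
  ends :: "'e \<Rightarrow> 'v set"

definition fin_mgraph :: "('v, 'e) mgraph \<Rightarrow> bool" where
  "fin_mgraph G \<longleftrightarrow> finite (verts G) \<and> finite (edges G) \<and>
     (\<forall>e\<in>edges G. \<exists>u\<in>verts G. \<exists>v\<in>verts G. ends G e = {u, v})"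

definition edge_cut :: "('v, 'e) mgraph \<Rightarrow> 'v set \<Rightarrow> 'e set" where
  "edge_cut G X = {e \<in> edges G. \<exists>u v. ends G e = {u, v} \<and> u \<in> X \<and> v \<notin> X}"

text \<open>A loop contributes 2 to the degree of its vertex.\<close>

definition degree :: "('v, 'e) mgraph \<Rightarrow> 'v \<Rightarrow> nat" where
  "degree G v = card {e \<in> edges G. v \<in> ends G e} + card {e \<in> edges G. ends G e = {v}}"

definition cubic :: "('v, 'e) mgraph \<Rightarrow> bool" where
  "cubic G \<longleftrightarrow> (\<forall>v\<in>verts G. degree G v = 3)"

definition adj :: "('v, 'e) mgraph \<Rightarrow> ('v \<times> 'v) set" where
  "adj G = {(u, v). \<exists>e\<in>edges G. ends G e = {u, v}}"

definition connected :: "('v, 'e) mgraph \<Rightarrow> bool" where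
  "connected G \<longleftrightarrow> verts G \<noteq> {} \<and> (\<forall>u\<in>verts G. \<forall>v\<in>verts G. (u, v) \<in> (adj G)\<^sup>*)"

definition del_edges :: "('v, 'e) mgraph \<Rightarrow> 'e set \<Rightarrow> ('v, 'e) mgraph" where
  "del_edges G F = G\<lparr>edges := edges G - F\<rparr>"

definition edge_connected :: "nat \<Rightarrow> ('v, 'e) mgraph \<Rightarrow> bool" where
  "edge_connected k G \<longleftrightarrow> (\<forall>F\<subseteq>edges G. card F < k \<longrightarrow> connected (del_edges G F))"

definition cubic_3_edge_connected :: "('v, 'e) mgraph \<Rightarrow> bool" where
  "cubic_3_edge_connected G \<longleftrightarrow> fin_mgraph G \<and> cubic G \<and> edge_connected 3 G"

definition induced :: "('v, 'e) mgraph \<Rightarrow> 'v set \<Rightarrow> ('v, 'e) mgraph" where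
  "induced G S = G\<lparr>verts := S, edges := {e \<in> edges G. ends G e \<subseteq> S}\<rparr>"

text \<open>Components are subgraphs, not vertex sets.\<close>

definition components :: "('v, 'e) mgraph \<Rightarrow> ('v, 'e) mgraph set" where
  "components G = {induced G {v \<in> verts G. (u, v) \<in> (adj G)\<^sup>*} | u. u \<in> verts G}"

text \<open>Cycles of length 1 (loops) and 2 (pairs of parallel edges) are included.\<close>

definition is_cycle :: "('v, 'e) mgraph \<Rightarrow> 'v list \<Rightarrow> 'e list \<Rightarrow> bool" where
  "is_cycle G vs es \<longleftrightarrow>
     vs \<noteq> [] \<and> length es = length vs \<and> distinct vs \<and> distinct es \<and> set es \<subseteq> edges G \<and>
     (\<forall>i<length vs. ends G (es ! i) = {vs ! i, vs ! (Suc i mod length vs)})"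

definition tree :: "('v, 'e) mgraph \<Rightarrow> bool" where
  "tree T \<longleftrightarrow> fin_mgraph T \<and> connected T \<and> (\<nexists>vs es. is_cycle T vs es)"

definition preim :: "('v, 'e) mgraph \<Rightarrow> ('v \<Rightarrow> 't) \<Rightarrow> 't set \<Rightarrow> 'v set" where
  "preim H \<phi> S = {v \<in> verts H. \<phi> v \<in> S}"

definition min_cut_side :: "('v, 'e) mgraph \<Rightarrow> 'v set \<Rightarrow> bool" where
  "min_cut_side H X \<longleftrightarrow> X \<noteq> {} \<and> X \<subset> verts H \<and> card (edge_cut H X) = 3"

definition cactus_tree ::
  "('v, 'e) mgraph \<Rightarrow> ('t, 'f) mgraph \<Rightarrow> ('v \<Rightarrow> 't) \<Rightarrow> bool" where
  "cactus_tree H T \<phi> \<longleftrightarrow>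
     cubic_3_edge_connected H \<and> tree T \<and> \<phi> ` verts H \<subseteq> verts T \<and>
     (\<forall>f\<in>edges T. \<forall>C\<in>components (del_edges T {f}). min_cut_side H (preim H \<phi> (verts C))) \<and>
     (\<forall>X. min_cut_side H X \<longrightarrow>
        (\<exists>f\<in>edges T. \<exists>C\<in>components (del_edges T {f}). X = preim H \<phi> (verts C)))"

text \<open>
  \<open>contract G A\<close> is \<open>G/A\<close>: the new vertex is \<open>None\<close>, and a vertex \<open>v\<close> outside \<open>A\<close> is kept
  as \<open>Some v\<close>. Parallel edges survive since edges keep their names.
\<close>

definition quot :: "'v set \<Rightarrow> 'v \<Rightarrow> 'v option" where
  "quot A v = (if v \<in> A then None else Some v)"

definition contract :: "('v, 'e) mgraph \<Rightarrow> 'v set \<Rightarrow> ('v option, 'e) mgraph" where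
  "contract G A =
     \<lparr>verts = quot A ` verts G,
      edges = {e \<in> edges G. \<nexists>w. quot A ` ends G e = {w}},
      ends = (\<lambda>e. quot A ` ends G e)\<rparr>"

text \<open>For a subgraph \<open>S\<close> of \<open>T\<close> and an edge \<open>e\<close> of \<open>T\<close>, this is \<open>S + e\<close>.\<close>

definition add_edge :: "('t, 'f) mgraph \<Rightarrow> 'f \<Rightarrow> ('t, 'f) mgraph" where
  "add_edge S e = S\<lparr>verts := verts S \<union> ends S e, edges := insert e (edges S)\<rparr>"

end

theory Submission
  imports Defs
begin

text \<open>
  Every notion involved is a statement about edge cuts: a component is an inclusion-minimal
  nonempty vertex set with empty cut, and \<open>k\<close>-edge-connectedness says that all proper cuts have
  at least \<open>k\<close> edges. Cuts of \<open>G/A\<close> are the cuts of \<open>G\<close> that do not split \<open>A\<close>, and cuts of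
  \<open>T\<^sub>1' + e\<close>, which is \<open>T/V(T\<^sub>2')\<close>, are the cuts of \<open>T\<close> that do not split \<open>V(T\<^sub>2')\<close>; the maps
  \<open>\<phi>\<close> and \<open>\<phi>\<^sub>1\<close> are compatible with these two correspondences. A component of \<open>T - f\<close> does
  not split \<open>V(T\<^sub>2')\<close> unless \<open>f\<close> lies in \<open>T\<^sub>2'\<close>. In the latter case it does not split
  \<open>V(T\<^sub>1')\<close>, so a minimum cut that it induces and that does not split \<open>A\<close> is \<open>A\<close> or its
  complement, which are also induced by \<open>e\<close>.
\<close>

section \<open>Components and connectedness in terms of cuts\<close>

lemma fin_mgraph_ends:
  assumes "fin_mgraph G" "e \<in> edges G"
  obtains u v where "u \<in> verts G" "v \<in> verts G" "ends G e = {u, v}"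
  using assms unfolding fin_mgraph_def by blast

text \<open>The existential in \<open>edge_cut\<close> ranges over both orders of the endpoints,
  hence the exclusive or; for a loop both sides are false.\<close>

lemma edge_cut_iff:
  "ends G e = {u, v} \<Longrightarrow> e \<in> edge_cut G X \<longleftrightarrow> e \<in> edges G \<and> (u \<in> X) \<noteq> (v \<in> X)"
  unfolding edge_cut_def by (auto simp: doubleton_eq_iff)

lemma edge_cut_del_edges: "edge_cut (del_edges G F) X = edge_cut G X - F"
  unfolding edge_cut_def del_edges_def by auto

lemma verts_del_edges [simp]: "verts (del_edges G F) = verts G"
  by (simp add: del_edges_def)

lemma sym_adj: "sym (adj G)"
  unfolding adj_def sym_def by (auto simp: insert_commute)

lemma reach_closed:
  assumes "edge_cut G Y = {}" "u \<in> Y" "(u, v) \<in> (adj G)\<^sup>*"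
  shows "v \<in> Y"
  using assms(3,2)
proof (induction rule: rtrancl_induct)
  case (step y z)
  then show ?case using assms(1) unfolding adj_def edge_cut_def by blast
qed

definition reach :: "('v, 'e) mgraph \<Rightarrow> 'v \<Rightarrow> 'v set" where
  "reach G u = {v \<in> verts G. (u, v) \<in> (adj G)\<^sup>*}"

lemma edge_cut_reach:
  assumes "\<forall>e\<in>edges G. ends G e \<subseteq> verts G"
  shows "edge_cut G (reach G u) = {}"
proof -
  have False if e: "e \<in> edges G" "ends G e = {a, b}" "a \<in> reach G u" "b \<notin> reach G u" for e a b
  proof -
    have "(a, b) \<in> adj G" using e unfolding adj_def by blast
    then have "(u, b) \<in> (adj G)\<^sup>*"
      using e(3) unfolding reach_def by (auto intro: rtrancl.rtrancl_into_rtrancl)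
    moreover have "b \<in> verts G" using assms e by auto
    ultimately show False using e(4) unfolding reach_def by blast
  qed
  then show ?thesis unfolding edge_cut_def by blast
qed

text \<open>A set with empty cut is closed under reachability; conversely every reachability class
  has empty cut, so it must be everything.\<close>

lemma connected_iff_cut:
  assumes "\<forall>e\<in>edges G. ends G e \<subseteq> verts G"
  shows "connected G \<longleftrightarrow> verts G \<noteq> {} \<and>
    (\<forall>Y. Y \<noteq> {} \<and> Y \<subseteq> verts G \<and> edge_cut G Y = {} \<longrightarrow> Y = verts G)" (is "?L \<longleftrightarrow> ?R")
proof
  assume ?L
  have "Y = verts G" if Y: "Y \<noteq> {}" "Y \<subseteq> verts G" "edge_cut G Y = {}" for Y
  proof -
    obtain y where "y \<in> Y" using Y by blast
    then show ?thesis using \<open>?L\<close> Y(2) reach_closed[OF Y(3)] unfolding connected_def by blast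
  qed
  then show ?R using \<open>?L\<close> unfolding connected_def by simp
next
  assume R: ?R
  have "reach G u = verts G" if "u \<in> verts G" for u
  proof -
    have "u \<in> reach G u" using that by (simp add: reach_def)
    moreover have "reach G u \<subseteq> verts G" by (auto simp: reach_def)
    ultimately show ?thesis using R edge_cut_reach[OF assms] by blast
  qed
  then show ?L unfolding connected_def using R by (auto simp: reach_def)
qed

text \<open>Walk-free description of the vertex sets of components. Only cuts enter, so it can be
  carried along a contraction.\<close>

definition component_set :: "('v, 'e) mgraph \<Rightarrow> 'v set \<Rightarrow> bool" where
  "component_set G S \<longleftrightarrow> S \<noteq> {} \<and> S \<subseteq> verts G \<and> edge_cut G S = {} \<and>
     (\<forall>Y. Y \<noteq> {} \<and> Y \<subseteq> S \<and> edge_cut G Y = {} \<longrightarrow> Y = S)"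

lemma components_eq: "components G = (\<lambda>u. induced G (reach G u)) ` verts G"
  unfolding components_def reach_def by blast

text \<open>A nonempty set with empty cut inside the class of \<open>u\<close> contains
  \<open>u\<close>, because \<open>adj\<close> is symmetric, and hence the whole class. Conversely a
  minimal set contains the class of each of its vertices, and minimality forces equality.\<close>

lemma verts_components:
  assumes wf: "\<forall>e\<in>edges G. ends G e \<subseteq> verts G"
  shows "verts ` components G = {S. component_set G S}"
proof -
  have "component_set G (reach G u)" if u: "u \<in> verts G" for u
  proof -
    have "Y = reach G u" if Y: "Y \<noteq> {}" "Y \<subseteq> reach G u" "edge_cut G Y = {}" for Y
    proof -
      obtain y where y: "y \<in> Y" using Y by blast
      have "(u, y) \<in> (adj G)\<^sup>*" using y Y(2) unfolding reach_def by blast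
      then have "(y, u) \<in> (adj G)\<^sup>*" by (rule symD[OF sym_rtrancl[OF sym_adj]])
      then have "u \<in> Y" by (rule reach_closed[OF Y(3) y])
      then show ?thesis using Y(2) reach_closed[OF Y(3)] unfolding reach_def by blast
    qed
    moreover have "u \<in> reach G u" using u by (simp add: reach_def)
    ultimately show ?thesis
      using edge_cut_reach[OF wf, of u] unfolding component_set_def by (auto simp: reach_def)
  qed
  moreover have "S \<in> reach G ` verts G" if S: "component_set G S" for S
  proof -
    obtain u where u: "u \<in> S" "u \<in> verts G" using S unfolding component_set_def by blast
    have "reach G u \<subseteq> S"
      using S reach_closed[of G S u] u(1) unfolding component_set_def reach_def by auto
    moreover have "u \<in> reach G u" using u by (simp add: reach_def)
    moreover have "Y = S" if "Y \<noteq> {}" "Y \<subseteq> S" "edge_cut G Y = {}" for Y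
      using S that unfolding component_set_def by simp
    ultimately have "reach G u = S" using edge_cut_reach[OF wf, of u] by blast
    then show ?thesis using u by blast
  qed
  ultimately show ?thesis
    unfolding components_eq image_image by (auto simp: induced_def)
qed

text \<open>Deleting \<open>F\<close> disconnects a nonempty graph exactly when \<open>F\<close>
  contains the cut of a proper nonempty set, so the smallest such \<open>F\<close> are themselves
  cuts.\<close>

lemma edge_connected_iff_cut:
  assumes "fin_mgraph G" "k > 0"
  shows "edge_connected k G \<longleftrightarrow> verts G \<noteq> {} \<and>
    (\<forall>Y. Y \<noteq> {} \<and> Y \<subset> verts G \<longrightarrow> k \<le> card (edge_cut G Y))" (is "?L \<longleftrightarrow> ?R")
proof -
  have wf: "\<forall>e\<in>edges (del_edges G F). ends (del_edges G F) e \<subseteq> verts (del_edges G F)" for F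
    using assms(1) unfolding fin_mgraph_def del_edges_def by auto
  note conn = connected_iff_cut[OF wf, unfolded edge_cut_del_edges verts_del_edges]
  show ?thesis
  proof
    assume L: ?L
    have "k \<le> card (edge_cut G Y)" if Y: "Y \<noteq> {}" "Y \<subset> verts G" for Y
    proof (rule ccontr)
      assume "\<not> ?thesis"
      moreover have "edge_cut G Y \<subseteq> edges G" by (auto simp: edge_cut_def)
      ultimately have "connected (del_edges G (edge_cut G Y))"
        using L unfolding edge_connected_def by auto
      then show False using Y unfolding conn by auto
    qed
    \<comment> \<open>Positivity of \<open>k\<close> permits deleting nothing, which shows that
      there is a vertex.\<close>
    moreover have "connected (del_edges G {})"
      using L[unfolded edge_connected_def, rule_format, of "{}"] assms(2) by simp
    ultimately show ?R unfolding conn by blast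
  next
    assume R: ?R
    have "connected (del_edges G F)" if F: "F \<subseteq> edges G" "card F < k" for F
    proof -
      have "finite F" using F(1) assms(1) finite_subset unfolding fin_mgraph_def by metis
      have "Y = verts G" if Y: "Y \<noteq> {} \<and> Y \<subseteq> verts G \<and> edge_cut G Y - F = {}" for Y
      proof (rule ccontr)
        assume "Y \<noteq> verts G"
        then have "k \<le> card (edge_cut G Y)" using R Y by blast
        moreover have "card (edge_cut G Y) \<le> card F"
          using Y by (intro card_mono[OF \<open>finite F\<close>]) blast
        ultimately show False using F(2) by simp
      qed
      then show ?thesis unfolding conn using R by blast
    qed
    then show ?L unfolding edge_connected_def by blast
  qed
qed

text \<open>Only an inequality, since a loop at \<open>v\<close> counts in the degree but lies in no
  cut.\<close>

lemma card_edge_cut_singleton_le: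
  assumes "fin_mgraph G"
  shows "card (edge_cut G {v}) \<le> degree G v"
proof -
  have "card (edge_cut G {v}) \<le> card {e \<in> edges G. v \<in> ends G e}"
    using assms by (intro card_mono) (auto simp: edge_cut_def fin_mgraph_def)
  then show ?thesis by (simp add: degree_def)
qed

lemma degree_loopless:
  assumes "fin_mgraph G" "\<forall>e\<in>edges G. \<nexists>w. ends G e = {w}"
  shows "degree G v = card (edge_cut G {v})"
proof -
  have "{e \<in> edges G. v \<in> ends G e} = edge_cut G {v}"
  proof (intro set_eqI)
    fix e
    show "e \<in> {e \<in> edges G. v \<in> ends G e} \<longleftrightarrow> e \<in> edge_cut G {v}"
    proof (cases "e \<in> edges G")
      case True
      then obtain a b where ab: "ends G e = {a, b}"
        using fin_mgraph_ends assms(1) by metis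
      moreover from this have "a \<noteq> b" using assms(2) True by auto
      ultimately show ?thesis by (auto simp: edge_cut_iff)
    qed (simp add: edge_cut_def)
  qed
  moreover have "{e \<in> edges G. ends G e = {v}} = {}" using assms(2) by blast
  ultimately show ?thesis unfolding degree_def by (simp only: card.empty add_0_right)
qed

section \<open>Contraction\<close>

text \<open>Preimage under the quotient map; such a set never splits \<open>A\<close>.\<close>

definition pull :: "('v, 'e) mgraph \<Rightarrow> 'v set \<Rightarrow> 'v option set \<Rightarrow> 'v set" where
  "pull G A X = {v \<in> verts G. quot A v \<in> X}"

lemma fin_mgraph_contract:
  assumes "fin_mgraph G"
  shows "fin_mgraph (contract G A)"
proof -
  have "\<exists>u\<in>quot A ` verts G. \<exists>v\<in>quot A ` verts G. quot A ` ends G e = {u, v}"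
    if e: "e \<in> edges G" for e
  proof -
    obtain u v where "u \<in> verts G" "v \<in> verts G" "ends G e = {u, v}"
      using fin_mgraph_ends[OF assms e] .
    then show ?thesis by auto
  qed
  then show ?thesis
    using assms unfolding fin_mgraph_def contract_def by simp
qed

text \<open>An edge that becomes a loop, and is therefore dropped, has both ends on the same side of
  every pulled-back set. The edge sets agree literally because edges keep their names.\<close>

lemma edge_cut_contract:
  assumes "fin_mgraph G"
  shows "edge_cut (contract G A) X = edge_cut G (pull G A X)"
proof (rule set_eqI)
  fix e
  show "e \<in> edge_cut (contract G A) X \<longleftrightarrow> e \<in> edge_cut G (pull G A X)"
  proof (cases "e \<in> edges G")
    case True
    then obtain u v where uv: "u \<in> verts G" "v \<in> verts G" "ends G e = {u, v}"
      using fin_mgraph_ends assms by metis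
    then have "ends (contract G A) e = {quot A u, quot A v}" by (simp add: contract_def)
    moreover have "e \<in> edges (contract G A) \<longleftrightarrow> quot A u \<noteq> quot A v"
      using True uv by (auto simp: contract_def doubleton_eq_iff)
    ultimately show ?thesis
      using uv True by (auto simp: edge_cut_iff pull_def)
  qed (simp add: edge_cut_def contract_def)
qed

text \<open>Taking preimages is injective because \<open>quot A\<close> maps onto the vertices of
  the contraction.\<close>

lemma pull_eq_iff:
  assumes "X \<subseteq> verts (contract G A)" "Y \<subseteq> verts (contract G A)"
  shows "pull G A X = pull G A Y \<longleftrightarrow> X = Y"
  using assms by (auto simp: pull_def contract_def set_eq_iff subset_iff image_iff)

lemma pull_proper_iff:
  assumes "X \<subseteq> verts (contract G A)"
  shows "pull G A X \<noteq> {} \<and> pull G A X \<subset> verts G \<longleftrightarrow> X \<noteq> {} \<and> X \<subset> verts (contract G A)"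
proof -
  have "pull G A {} = {}" "pull G A (verts (contract G A)) = verts G" "pull G A X \<subseteq> verts G"
    by (auto simp: pull_def contract_def)
  then show ?thesis
    using assms pull_eq_iff[of X G A "{}"] pull_eq_iff[of X G A "verts (contract G A)"] by auto
qed

lemma min_cut_side_contract:
  assumes "fin_mgraph G" "X \<subseteq> verts (contract G A)"
  shows "min_cut_side (contract G A) X \<longleftrightarrow> min_cut_side G (pull G A X)"
  unfolding min_cut_side_def edge_cut_contract[OF assms(1)]
  using pull_proper_iff[OF assms(2)] by blast

text \<open>Cuts of the contraction are cuts of \<open>G\<close>, which gives edge-connectivity. The
  contraction has no loops, so degrees are cut sizes too; at the new vertex this is the cut of
  \<open>A\<close>.\<close>

lemma cubic_3_edge_connected_contract:
  assumes G: "cubic_3_edge_connected G" and A: "min_cut_side G A"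
  shows "cubic_3_edge_connected (contract G A)"
proof -
  have fin: "fin_mgraph G" and cub: "cubic G" and conn: "edge_connected 3 G"
    using G unfolding cubic_3_edge_connected_def by auto
  have cut: "3 \<le> card (edge_cut G Y)" if "Y \<noteq> {}" "Y \<subset> verts G" for Y
    using conn that edge_connected_iff_cut[OF fin, of 3] by simp
  have fin': "fin_mgraph (contract G A)" by (rule fin_mgraph_contract[OF fin])
  have "edge_connected 3 (contract G A)"
    unfolding edge_connected_iff_cut[OF fin' zero_less_numeral] edge_cut_contract[OF fin]
  proof (intro conjI allI impI)
    show "verts (contract G A) \<noteq> {}"
      using A unfolding min_cut_side_def contract_def by auto
  next
    fix Y
    assume "Y \<noteq> {} \<and> Y \<subset> verts (contract G A)"
    then show "3 \<le> card (edge_cut G (pull G A Y))"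
      using pull_proper_iff[of Y G A] cut by blast
  qed
  moreover have "degree (contract G A) w = 3" if w: "w \<in> verts (contract G A)" for w
  proof -
    have "degree (contract G A) w = card (edge_cut G (pull G A {w}))"
      unfolding edge_cut_contract[OF fin, symmetric]
      by (rule degree_loopless[OF fin']) (auto simp: contract_def)
    also have "\<dots> = 3"
    proof (cases w)
      case None
      then have "pull G A {w} = A"
        using A unfolding min_cut_side_def pull_def quot_def by auto
      then show ?thesis using A unfolding min_cut_side_def by simp
    next
      case (Some v)
      then have v: "v \<in> verts G" "v \<notin> A" and eq: "pull G A {w} = {v}"
        using w unfolding pull_def quot_def contract_def by (auto split: if_splits)
      \<comment> \<open>Cubicity bounds the cut from above only; the lower bound is
        edge-connectivity, applicable because \<open>A\<close> supplies a further vertex.\<close>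
      have "card (edge_cut G {v}) \<le> 3"
        using card_edge_cut_singleton_le[OF fin, of v] cub v unfolding cubic_def by simp
      moreover have "{v} \<subset> verts G" using v A unfolding min_cut_side_def by auto
      ultimately show ?thesis using cut[of "{v}"] eq by simp
    qed
    finally show ?thesis .
  qed
  ultimately show ?thesis
    using fin' unfolding cubic_3_edge_connected_def cubic_def by blast
qed

section \<open>Splitting a tree at an edge\<close>

text \<open>An edge leaving \<open>S \<inter> Y\<close> either leaves \<open>S\<close>, so it is
  \<open>e\<close>, or leaves \<open>Y\<close> inside \<open>S\<close>, so it is \<open>f\<close>
  with both ends in \<open>S\<close>, and again \<open>e\<close>. Thus \<open>S \<inter> Y\<close>
  has empty cut after deleting \<open>e\<close>, and minimality of \<open>S\<close> applies.\<close>

lemma component_set_unsplit: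
  assumes T: "fin_mgraph T"
    and S: "component_set (del_edges T {e}) S"
    and Y: "edge_cut T Y \<subseteq> {f}" and f: "f = e \<or> \<not> ends T f \<subseteq> S"
  shows "S \<subseteq> Y \<or> S \<inter> Y = {}"
proof -
  have cut: "edge_cut T S \<subseteq> {e}"
    and min: "\<And>Y. Y \<noteq> {} \<Longrightarrow> Y \<subseteq> S \<Longrightarrow> edge_cut T Y - {e} = {} \<Longrightarrow> Y = S"
    using S unfolding component_set_def edge_cut_del_edges by auto
  have "g = e" if g: "g \<in> edge_cut T (S \<inter> Y)" for g
  proof -
    obtain u v where uv: "ends T g = {u, v}" "g \<in> edges T"
      using g unfolding edge_cut_def by blast
    have "g \<in> edge_cut T S \<or> (g \<in> edge_cut T Y \<and> ends T g \<subseteq> S)"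
      using g uv by (auto simp: edge_cut_iff)
    then show ?thesis using cut Y f by auto
  qed
  then have "edge_cut T (S \<inter> Y) - {e} = {}" by blast
  then show ?thesis using min[of "S \<inter> Y"] by blast
qed

text \<open>The assumptions are symmetric under exchanging the indices 1 and 2, so two instances
  yield both halves of the tree.\<close>

locale tree_split =
  fixes T :: "('t, 'f) mgraph" and e :: 'f and x1 x2 :: 't and S1 S2 :: "'t set"
  assumes tree: "tree T"
    and e: "e \<in> edges T" "ends T e = {x1, x2}" "x1 \<in> S1" "x2 \<in> S2"
    and S1: "component_set (del_edges T {e}) S1"
    and S2: "component_set (del_edges T {e}) S2"
    and cover: "S1 \<union> S2 = verts T" and disj: "S1 \<inter> S2 = {}"
begin

text \<open>
  \<open>half\<close> is \<open>T\<close> with \<open>S2\<close> contracted to \<open>x2\<close>, and \<open>lift\<close> takes preimages under this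
  contraction.
\<close>

definition half :: "('t, 'f) mgraph" where
  "half = add_edge (induced (del_edges T {e}) S1) e"

definition lift :: "'t set \<Rightarrow> 't set" where
  "lift C = (if x2 \<in> C then C \<union> S2 else C)"

lemma fin: "fin_mgraph T"
  using tree unfolding tree_def by blast

lemma half_simps:
  "verts half = insert x2 S1" "ends half = ends T"
  "edges half = insert e {f \<in> edges T. ends T f \<subseteq> S1}"
  using e disj unfolding half_def add_edge_def induced_def del_edges_def by auto

text \<open>Only \<open>e\<close> can leave \<open>S1\<close>; every other edge lies inside
  \<open>S1\<close> or inside \<open>S2\<close>.\<close>

lemma edge_cases:
  assumes "f \<in> edges T"
  shows "f \<in> edges half \<or> ends T f \<subseteq> S2"
proof (cases "f = e")
  case False
  obtain u v where uv: "u \<in> verts T" "v \<in> verts T" "ends T f = {u, v}"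
    using fin_mgraph_ends fin assms by metis
  have "f \<notin> edge_cut T S1"
    using S1 False unfolding component_set_def edge_cut_del_edges by blast
  then show ?thesis using uv assms cover by (auto simp: edge_cut_iff half_simps)
qed (simp add: half_simps)

lemma half_not_in_S2:
  assumes "f \<in> edges half"
  shows "f \<in> edges T" "\<not> ends T f \<subseteq> S2"
proof -
  show f: "f \<in> edges T" using assms e by (auto simp: half_simps)
  then obtain u v where "ends T f = {u, v}" using fin_mgraph_ends fin by metis
  then show "\<not> ends T f \<subseteq> S2" using assms e disj by (auto simp: half_simps)
qed

lemma fin_half: "fin_mgraph half"
proof -
  have "S1 \<subseteq> verts T" using cover by blast
  moreover have "\<exists>u\<in>insert x2 S1. \<exists>v\<in>insert x2 S1. ends T f = {u, v}"
    if f: "f \<in> edges half" for f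
  proof (cases "f = e")
    case False
    obtain u v where "ends T f = {u, v}"
      using fin_mgraph_ends fin half_not_in_S2(1)[OF f] by metis
    then show ?thesis using f False by (auto simp: half_simps)
  qed (use e in auto)
  ultimately show ?thesis
    using fin finite_subset unfolding fin_mgraph_def half_simps(1,2)
    by (auto simp: half_simps(3))
qed

lemma edge_cut_half:
  assumes "Y \<subseteq> verts half"
  shows "edge_cut half Y = edge_cut T (lift Y)"
proof (rule set_eqI)
  fix f
  show "f \<in> edge_cut half Y \<longleftrightarrow> f \<in> edge_cut T (lift Y)"
  proof (cases "f \<in> edges T")
    case True
    then obtain u v where uv: "u \<in> verts T" "v \<in> verts T" "ends T f = {u, v}"
      using fin_mgraph_ends fin by metis
    \<comment> \<open>A lifted set treats \<open>S2\<close> as one point and agrees with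
      \<open>Y\<close> on the vertices of \<open>half\<close>: edges inside \<open>S2\<close> are
      not cut, and edges of \<open>half\<close> are cut alike.\<close>
    have Y: "w \<in> lift Y \<longleftrightarrow> x2 \<in> Y" if "w \<in> S2" for w
      using that disj assms e(4) by (auto simp: lift_def half_simps)
    have Y': "w \<in> lift Y \<longleftrightarrow> w \<in> Y" if "w = x2 \<or> w \<in> S1" for w
      using that disj e(4) by (auto simp: lift_def)
    show ?thesis
    proof (cases "f \<in> edges half")
      case f: True
      then have "u \<in> insert x2 S1" "v \<in> insert x2 S1"
        using uv e by (auto simp: half_simps)
      then show ?thesis
        using f uv True Y' by (simp add: edge_cut_iff[of _ _ u v] half_simps(2))
    next
      case f: False
      then have "ends T f \<subseteq> S2" using edge_cases True by blast
      then show ?thesis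
        using f uv True Y by (simp add: edge_cut_iff[of _ _ u v] half_simps(2))
    qed
  next
    case False
    then show ?thesis using half_not_in_S2(1) by (auto simp: edge_cut_def)
  qed
qed

lemma lift_empty_iff: "lift C = {} \<longleftrightarrow> C = {}"
  by (auto simp: lift_def)

text \<open>Together with \<open>inter_lift\<close>, this makes \<open>lift\<close> a bijection from
  the vertex sets of \<open>half\<close> to those of \<open>T\<close> that do not split
  \<open>S2\<close>; the inverse is the trace on \<open>half\<close>, where \<open>x2\<close>
  represents \<open>S2\<close>.\<close>

lemma lift_inter:
  assumes "C \<subseteq> verts T" "S2 \<subseteq> C \<or> S2 \<inter> C = {}"
  shows "lift (C \<inter> verts half) = C"
  using assms cover e(4) by (auto simp: lift_def half_simps)

lemma inter_lift: "C \<subseteq> verts half \<Longrightarrow> lift C \<inter> verts half = C"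
  using disj e(4) by (auto simp: lift_def half_simps)

lemma lift_subset: "C \<subseteq> verts half \<Longrightarrow> lift C \<subseteq> verts T"
  using cover e(4) by (auto simp: lift_def half_simps)

lemma unsplit:
  assumes "f \<in> edges half" "edge_cut T C \<subseteq> {f}"
  shows "S2 \<subseteq> C \<or> S2 \<inter> C = {}"
  using component_set_unsplit[OF fin S2 assms(2)] half_not_in_S2(2)[OF assms(1)] by blast

text \<open>A competitor \<open>Y\<close> to the minimality of \<open>lift C\<close> has its cut
  within \<open>{f}\<close>, so it does not split \<open>S2\<close> and is the lift of its trace.
  Minimality of \<open>C\<close> then applies to the trace.\<close>

lemma component_set_lift:
  assumes f: "f \<in> edges half" and C: "component_set (del_edges half {f}) C"
  shows "component_set (del_edges T {f}) (lift C)"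
proof -
  have sub: "C \<subseteq> verts half" and ne: "C \<noteq> {}" using C unfolding component_set_def by auto
  have min: "\<And>Y. Y \<noteq> {} \<Longrightarrow> Y \<subseteq> C \<Longrightarrow> edge_cut half Y - {f} = {} \<Longrightarrow> Y = C"
    using C unfolding component_set_def edge_cut_del_edges by simp
  have "Y = lift C" if Y: "Y \<noteq> {}" "Y \<subseteq> lift C" "edge_cut T Y - {f} = {}" for Y
  proof -
    let ?Y = "Y \<inter> verts half"
    have lift: "lift ?Y = Y"
    proof (rule lift_inter)
      show "Y \<subseteq> verts T" using lift_subset[OF sub] Y(2) by blast
      show "S2 \<subseteq> Y \<or> S2 \<inter> Y = {}" using Y(3) by (intro unsplit[OF f]) blast
    qed
    \<comment> \<open>Rewritten with \<open>lift\<close>, the instance of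
      \<open>lift_empty_iff\<close> says that \<open>Y\<close> is empty iff its trace is.\<close>
    have "?Y \<noteq> {}"
      unfolding lift_empty_iff[of ?Y, unfolded lift, symmetric] by (rule Y(1))
    moreover have "?Y \<subseteq> C" using Y(2) inter_lift[OF sub] by blast
    moreover have "edge_cut half ?Y - {f} = {}" using edge_cut_half[of ?Y] lift Y(3) by simp
    ultimately have "?Y = C" by (rule min)
    then show ?thesis using lift by simp
  qed
  moreover have "lift C \<noteq> {}" using ne by (simp add: lift_empty_iff)
  ultimately show ?thesis
    using C lift_subset[OF sub] edge_cut_half[OF sub]
    unfolding component_set_def edge_cut_del_edges by auto
qed

text \<open>The converse transfer: \<open>C\<close> does not split \<open>S2\<close>, and a
  competitor inside the trace lifts to a competitor inside \<open>C\<close>.\<close>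

lemma component_set_unlift:
  assumes f: "f \<in> edges half" and C: "component_set (del_edges T {f}) C"
  shows "component_set (del_edges half {f}) (C \<inter> verts half)" "lift (C \<inter> verts half) = C"
proof -
  let ?C = "C \<inter> verts half"
  have sub: "C \<subseteq> verts T" and cut: "edge_cut T C \<subseteq> {f}"
    using C unfolding component_set_def edge_cut_del_edges by auto
  show lift: "lift ?C = C" using lift_inter[OF sub] unsplit[OF f cut] by blast
  have "Y = ?C" if Y: "Y \<noteq> {}" "Y \<subseteq> ?C" "edge_cut half Y - {f} = {}" for Y
  proof -
    have sub: "Y \<subseteq> verts half" using Y by blast
    have "lift Y \<subseteq> lift ?C" using Y(2) by (auto simp: lift_def)
    moreover have "lift Y \<noteq> {}" using Y(1) by (simp add: lift_empty_iff)
    ultimately have "lift Y = C"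
      using C Y(3) edge_cut_half[OF sub] lift
      unfolding component_set_def edge_cut_del_edges by auto
    then show ?thesis using inter_lift[OF sub] by blast
  qed
  moreover have "?C \<noteq> {}"
    unfolding lift_empty_iff[of ?C, unfolded lift, symmetric]
    using C unfolding component_set_def by (rule conjunct1)
  moreover have "edge_cut half ?C - {f} = {}"
    using edge_cut_half[of ?C] lift cut by auto
  ultimately show "component_set (del_edges half {f}) ?C"
    unfolding component_set_def edge_cut_del_edges verts_del_edges by blast
qed

text \<open>Connectedness transfers through the equality of cuts. A cycle of \<open>half\<close> is
  literally a cycle of \<open>T\<close>, since \<open>is_cycle\<close> refers only to edges and
  their ends.\<close>

lemma tree_half: "tree half"
proof -
  have wf: "fin_mgraph H \<Longrightarrow> \<forall>f\<in>edges H. ends H f \<subseteq> verts H" for H :: "('t, 'f) mgraph"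
    unfolding fin_mgraph_def by auto
  have conn: "connected T" and acyc: "\<nexists>vs es. is_cycle T vs es"
    using tree unfolding tree_def by auto
  have "connected half"
    unfolding connected_iff_cut[OF wf[OF fin_half]]
  proof (intro conjI allI impI)
    show "verts half \<noteq> {}" by (simp add: half_simps)
  next
    fix Y
    assume Y: "Y \<noteq> {} \<and> Y \<subseteq> verts half \<and> edge_cut half Y = {}"
    then have "lift Y = verts T"
      using conn lift_subset[of Y] edge_cut_half[of Y]
      unfolding connected_iff_cut[OF wf[OF fin]] by (auto simp: lift_def)
    moreover have "verts half \<subseteq> verts T" using cover e(4) by (auto simp: half_simps)
    ultimately show "Y = verts half" using inter_lift[of Y] Y by blast
  qed
  moreover have "is_cycle T vs es" if "is_cycle half vs es" for vs es
    using that half_not_in_S2(1) unfolding is_cycle_def half_simps(2) by blast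
  ultimately show ?thesis using fin_half acyc unfolding tree_def by blast
qed

end

section \<open>Cactus trees\<close>

lemma cactus_tree_iff:
  assumes "fin_mgraph T"
  shows "cactus_tree H T \<phi> \<longleftrightarrow>
     cubic_3_edge_connected H \<and> tree T \<and> \<phi> ` verts H \<subseteq> verts T \<and>
     (\<forall>f\<in>edges T. \<forall>C. component_set (del_edges T {f}) C \<longrightarrow> min_cut_side H (preim H \<phi> C)) \<and>
     (\<forall>X. min_cut_side H X \<longrightarrow>
        (\<exists>f\<in>edges T. \<exists>C. component_set (del_edges T {f}) C \<and> X = preim H \<phi> C))"
proof -
  have "\<forall>f\<in>edges (del_edges T F). ends (del_edges T F) f \<subseteq> verts (del_edges T F)" for F
    using assms unfolding fin_mgraph_def del_edges_def by auto
  note comp = verts_components[OF this]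
  have all: "(\<forall>C\<in>components (del_edges T F). P (verts C)) \<longleftrightarrow>
      (\<forall>C. component_set (del_edges T F) C \<longrightarrow> P C)" for F P
    using comp[of F] by (metis (mono_tags, lifting) imageE imageI mem_Collect_eq)
  \<comment> \<open>Dual of \<open>all\<close>, by negating \<open>P\<close>.\<close>
  have ex: "(\<exists>C\<in>components (del_edges T F). P (verts C)) \<longleftrightarrow>
      (\<exists>C. component_set (del_edges T F) C \<and> P C)" for F P
    using all[of F "\<lambda>C. \<not> P C"] by blast
  show ?thesis
    unfolding cactus_tree_def all[of "{f}" "\<lambda>C. min_cut_side H (preim H \<phi> C)" for f]
      ex[of "{f}" "\<lambda>C. X = preim H \<phi> C" for f X] ..
qed

lemma cactus_tree_half:
  fixes G :: "('v, 'e) mgraph"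
  assumes "tree_split T e x1 x2 S1 S2" and cactus: "cactus_tree G T \<phi>"
  defines "A \<equiv> preim G \<phi> S2"
  shows "cactus_tree (contract G A) (tree_split.half T e S1)
    (\<lambda>w. case w of None \<Rightarrow> x2 | Some v \<Rightarrow> \<phi> v)"
proof -
  interpret tree_split T e x1 x2 S1 S2 by fact
  let ?\<psi> = "\<lambda>w. case w of None \<Rightarrow> x2 | Some v \<Rightarrow> \<phi> v"
  let ?H = "contract G A"
  have G: "cubic_3_edge_connected G" and \<phi>: "\<phi> ` verts G \<subseteq> verts T"
    and cut: "\<And>f C. f \<in> edges T \<Longrightarrow> component_set (del_edges T {f}) C
      \<Longrightarrow> min_cut_side G (preim G \<phi> C)"
    and side: "\<And>X. min_cut_side G X \<Longrightarrow>
      \<exists>f\<in>edges T. \<exists>C. component_set (del_edges T {f}) C \<and> X = preim G \<phi> C"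
    using cactus unfolding cactus_tree_iff[OF fin] by blast+
  have finG: "fin_mgraph G" using G unfolding cubic_3_edge_connected_def by blast
  have A: "min_cut_side G A" unfolding A_def by (rule cut[OF e(1) S2])
  have compl: "verts G - A = preim G \<phi> S1"
    using \<phi> cover disj unfolding A_def preim_def by auto
  have sub: "preim ?H ?\<psi> C \<subseteq> verts ?H" for C by (auto simp: preim_def)
  \<comment> \<open>The square commutes: as \<open>A\<close> is the preimage of \<open>S2\<close>,
    the map \<open>?\<psi>\<close> after \<open>quot A\<close> equals \<open>\<phi>\<close> followed
    by collapsing \<open>S2\<close> to \<open>x2\<close>.\<close>
  have pull: "pull G A (preim ?H ?\<psi> C) = preim G \<phi> (lift C)" if "C \<subseteq> verts half" for C
    using that e(4) disj
    by (auto simp: pull_def preim_def contract_def quot_def A_def lift_def half_simps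
        split: option.splits if_splits)
  have image: "?\<psi> ` verts ?H \<subseteq> verts half"
  proof -
    have "\<phi> v \<in> S1" if "v \<in> verts G" "v \<notin> A" for v
      using that compl unfolding preim_def by blast
    then show ?thesis by (auto simp: contract_def quot_def half_simps)
  qed
  have fwd: "min_cut_side ?H (preim ?H ?\<psi> C)"
    if f: "f \<in> edges half" and C: "component_set (del_edges half {f}) C" for f C
  proof -
    have "C \<subseteq> verts half" using C unfolding component_set_def by simp
    then show ?thesis
      using cut[OF half_not_in_S2(1)[OF f] component_set_lift[OF f C]]
      unfolding min_cut_side_contract[OF finG sub] by (simp add: pull)
  qed
  have bwd: "\<exists>f\<in>edges half. \<exists>C. component_set (del_edges half {f}) C \<and> X = preim ?H ?\<psi> C"
    if X: "min_cut_side ?H X" for X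
  proof -
    have Xsub: "X \<subseteq> verts ?H" using X unfolding min_cut_side_def by blast
    then have pX: "min_cut_side G (pull G A X)"
      using X min_cut_side_contract[OF finG] by blast
    \<comment> \<open>It suffices to find the inducing edge in \<open>half\<close> while still
      working in \<open>T\<close>; \<open>component_set_unlift\<close> then moves the component to
      \<open>half\<close>.\<close>
    have "\<exists>f\<in>edges half. \<exists>C. component_set (del_edges T {f}) C \<and> pull G A X = preim G \<phi> C"
    proof -
      obtain f C where fC: "f \<in> edges T" "component_set (del_edges T {f}) C"
          "pull G A X = preim G \<phi> C"
        using side[OF pX] by blast
      show ?thesis
      proof (cases "f \<in> edges half")
        case False
        have "\<not> ends T f \<subseteq> S1" using False fC(1) by (simp add: half_simps)
        then have "S1 \<subseteq> C \<or> S1 \<inter> C = {}"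
          using component_set_unsplit[OF fin S1, of C f] fC(2)
          unfolding component_set_def edge_cut_del_edges by blast
        then have "verts G - A \<subseteq> pull G A X \<or> (verts G - A) \<inter> pull G A X = {}"
          unfolding compl fC(3) preim_def by blast
        moreover have "A \<subseteq> pull G A X \<or> A \<inter> pull G A X = {}"
          by (auto simp: pull_def quot_def A_def preim_def)
        moreover have "A \<subseteq> verts G" by (auto simp: A_def preim_def)
        ultimately have "pull G A X = verts G - A \<or> pull G A X = A"
          using pX unfolding min_cut_side_def by blast
        then have "pull G A X = preim G \<phi> S1 \<or> pull G A X = preim G \<phi> S2"
          using compl A_def by simp
        \<comment> \<open>The edge \<open>e\<close> replaces \<open>f\<close>: its two components
          \<open>S1\<close> and \<open>S2\<close> induce the two remaining possibilities.\<close>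
        moreover have "e \<in> edges half" by (simp add: half_simps)
        ultimately show ?thesis using S1 S2 by blast
      qed (use fC in blast)
    qed
    then obtain f C where f: "f \<in> edges half" and C: "component_set (del_edges T {f}) C"
        and eq: "pull G A X = preim G \<phi> C" by blast
    note un = component_set_unlift[OF f C]
    have "pull G A X = pull G A (preim ?H ?\<psi> (C \<inter> verts half))"
      using eq pull[of "C \<inter> verts half"] un(2) by simp
    then have "X = preim ?H ?\<psi> (C \<inter> verts half)"
      using pull_eq_iff[OF Xsub sub] by blast
    then show ?thesis using f un(1) by blast
  qed
  show ?thesis
    unfolding cactus_tree_iff[OF fin_half]
    using cubic_3_edge_connected_contract[OF G A] tree_half image fwd bwd by blast
qed

theorem theorem3:
  fixes G :: "('v, 'e) mgraph" and T T1' T2' :: "('t, 'f) mgraph"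
    and \<phi> :: "'v \<Rightarrow> 't" and A :: "'v set" and e :: 'f and x1 x2 :: 't
  assumes "cubic_3_edge_connected G"
    and "cactus_tree G T \<phi>"
    and "A \<subseteq> verts G" and "card (edge_cut G A) = 3"
    and "e \<in> edges T" and "ends T e = {x1, x2}"
    and "components (del_edges T {e}) = {T1', T2'}"
    and "x1 \<in> verts T1'" and "x2 \<in> verts T2'"
    and "A = preim G \<phi> (verts T2')"
  shows "cactus_tree (contract G A) (add_edge T1' e)
           (\<lambda>w. case w of None \<Rightarrow> x2 | Some v \<Rightarrow> \<phi> v)
       \<and> cactus_tree (contract G (verts G - A)) (add_edge T2' e)
           (\<lambda>w. case w of None \<Rightarrow> x1 | Some v \<Rightarrow> \<phi> v)"
proof -
  let ?D = "del_edges T {e}"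
  have tree: "tree T" and \<phi>: "\<phi> ` verts G \<subseteq> verts T"
    using assms(2) unfolding cactus_tree_def by auto
  then have fin: "fin_mgraph T" unfolding tree_def by blast
  have "\<forall>f\<in>edges ?D. ends ?D f \<subseteq> verts ?D"
    using fin unfolding fin_mgraph_def del_edges_def by auto
  from verts_components[OF this] have comp: "{S. component_set ?D S} = {verts T1', verts T2'}"
    using assms(7) by auto
  have S1: "component_set ?D (verts T1')" and S2: "component_set ?D (verts T2')"
    using comp by blast+
  \<comment> \<open>A component is recovered from its vertex set, which identifies
    \<open>add_edge T1' e\<close> and \<open>add_edge T2' e\<close> with the two instances of
    \<open>half\<close>.\<close>
  have "induced ?D (verts C) = C" if "C \<in> components ?D" for C
    using that unfolding components_eq by (auto simp: induced_def)
  then have ind: "induced ?D (verts T1') = T1'" "induced ?D (verts T2') = T2'"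
    using assms(7) by simp_all
  have cover: "verts T1' \<union> verts T2' = verts T"
  proof
    show "verts T1' \<union> verts T2' \<subseteq> verts T" using S1 S2 unfolding component_set_def by auto
  next
    show "verts T \<subseteq> verts T1' \<union> verts T2'"
    proof
      fix u
      assume u: "u \<in> verts T"
      then have "induced ?D (reach ?D u) \<in> {T1', T2'}"
        using assms(7) unfolding components_eq by auto
      moreover have "u \<in> verts (induced ?D (reach ?D u))"
        using u by (simp add: reach_def induced_def)
      ultimately show "u \<in> verts T1' \<union> verts T2'" by auto
    qed
  qed
  \<comment> \<open>The set \<open>{T1', T2'}\<close> might be a singleton. Then
    \<open>verts T2'\<close> would be all of \<open>verts T\<close> and \<open>A\<close> all of
    \<open>verts G\<close>, but a minimum cut side is proper.\<close>
  have "min_cut_side G A"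
    using assms(2,5,10) S2 unfolding cactus_tree_iff[OF fin] by blast
  then have "verts T2' \<noteq> verts T"
    using \<phi> assms(10) unfolding min_cut_side_def preim_def by auto
  then have ne: "verts T1' \<noteq> verts T2'" using cover by auto
  have disj: "verts T1' \<inter> verts T2' = {}"
  proof (rule ccontr)
    assume "\<not> ?thesis"
    \<comment> \<open>Here both edges in \<open>component_set_unsplit\<close> are \<open>e\<close>.
      Inclusion would force equality by minimality of \<open>verts T2'\<close>.\<close>
    moreover have "verts T1' \<subseteq> verts T2' \<or> verts T1' \<inter> verts T2' = {}"
      using component_set_unsplit[OF fin S1, of "verts T2'" e] S2
      unfolding component_set_def edge_cut_del_edges by blast
    ultimately show False
      using S1 S2 ne unfolding component_set_def by auto
  qed
  have split1: "tree_split T e x1 x2 (verts T1') (verts T2')"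
    using tree assms(5,6,8,9) S1 S2 cover disj by unfold_locales
  have split2: "tree_split T e x2 x1 (verts T2') (verts T1')"
    using tree assms(5,6,8,9) S1 S2 cover disj by unfold_locales auto
  \<comment> \<open>This puts the second contraction into the form required by the instance with
    exchanged sides.\<close>
  have "verts G - A = preim G \<phi> (verts T1')"
    using \<phi> cover disj unfolding assms(10) preim_def by auto
  then show ?thesis
    using cactus_tree_half[OF split1 assms(2)] cactus_tree_half[OF split2 assms(2)]
    unfolding tree_split.half_def[OF split1] tree_split.half_def[OF split2] ind
    using assms(10) by simp
qed

end
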